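(* Let $\mathcal S=(Cl_{1,0,1}(\mathbb R),*_1)$ be the $*$-algebra described in the context. Every self-adjoint square matrix $H$ over $\mathcal S$ is unitarily diagonalisable over $\mathcal S$, i.e. there are a unitary matrix $U$ over $\mathcal S$ and a diagonal matrix $D$ over $\mathcal S$ with $H=UDU^*$, and $U,D$ can be chosen so that each diagonal entry of $D$ (eigenvalue) is either a dual number, i.e. of the form $a+b\delta$ with $a,b\in\mathbb R$, or of the form $(x,y)\in\mathbb R\oplus\mathbb R$.
   Context: The real associative unital algebra $Cl_{1,0,1}(\mathbb R)$ has elements written uniquely as $(a,b)+(a',b')\delta$ with $a,b,a',b'\in\mathbb R$, where $(a,b),(a',b')$ lie in $\mathbb R\oplus\mathbb R$ (componentwise operations, unit $1=(1,1)$), and multiplication is determined by $\delta^2=0$ and $\delta(a',b')=(b',a')\delta$. The involution is $((a,b)+(a',b')\delta)^{*_1}=(a,b)+(b',a')\delta$. A real number $a$ is identified with $(a,a)$, so the dual number $a+b\delta$ means $(a,a)+(b,b)\delta$. For a matrix $M$ over a $*$-algebra, $(M^* )_{ij}=(M_{ji})^*$; $M$ is self-adjoint if $M^*=M$, and a square matrix $U$ is unitary if $U^*=U^{-1}$. *)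

theory Defs
  imports Complex_Main "Jordan_Normal_Form.Matrix"
begin

class star_algebra = real_algebra_1 +
  fixes star :: "'a \<Rightarrow> 'a"
  assumes star_star: "star (star x) = x"
    and star_add: "star (x + y) = star x + star y"
    and star_mult: "star (x * y) = star y * star x"
    and star_scaleR: "star (r *\<^sub>R x) = r *\<^sub>R star x"

text \<open>The algebra $Cl_{1,0,1}(R)$: the term \<open>Cl a b a' b'\<close> stands for $(a,b) + (a',b')\delta$.\<close>

datatype cl101 = Cl (cl1: real) (cl2: real) (cl3: real) (cl4: real)

text \<open>The product below is the expansion of
  $((a,b) + (a',b')\delta)((c,d) + (c',d')\delta)$ under $\delta^2 = 0$ and
  $\delta (c,d) = (d,c) \delta$, which are recovered as \<open>cl_delta_square\<close> and
  \<open>cl_delta_pair\<close>.\<close>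

instantiation cl101 :: star_algebra
begin

definition "0 = Cl 0 0 0 0"
definition "1 = Cl 1 1 0 0"
definition "x + y = Cl (cl1 x + cl1 y) (cl2 x + cl2 y) (cl3 x + cl3 y) (cl4 x + cl4 y)"
definition "- x = Cl (- cl1 x) (- cl2 x) (- cl3 x) (- cl4 x)"
definition "x - y = Cl (cl1 x - cl1 y) (cl2 x - cl2 y) (cl3 x - cl3 y) (cl4 x - cl4 y)"
definition "r *\<^sub>R x = Cl (r * cl1 x) (r * cl2 x) (r * cl3 x) (r * cl4 x)"
definition "x * y = Cl (cl1 x * cl1 y) (cl2 x * cl2 y)
  (cl1 x * cl3 y + cl3 x * cl2 y) (cl2 x * cl4 y + cl4 x * cl1 y)"
definition "star x = Cl (cl1 x) (cl2 x) (cl4 x) (cl3 x)"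

instance
  by standard
    (auto simp: zero_cl101_def one_cl101_def plus_cl101_def uminus_cl101_def minus_cl101_def
      scaleR_cl101_def times_cl101_def star_cl101_def algebra_simps)

end

definition cl_pair :: "real \<Rightarrow> real \<Rightarrow> cl101" where
  "cl_pair a b = Cl a b 0 0"

definition cl_delta :: cl101 where
  "cl_delta = Cl 0 0 1 1"

lemma Cl_eq: "Cl a b a' b' = cl_pair a b + cl_pair a' b' * cl_delta"
  by (simp add: cl_pair_def cl_delta_def plus_cl101_def times_cl101_def)

lemma cl_pair_mult: "cl_pair a b * cl_pair c d = cl_pair (a * c) (b * d)"
  by (simp add: cl_pair_def times_cl101_def)

lemma cl_delta_square: "cl_delta * cl_delta = 0"
  by (simp add: cl_delta_def times_cl101_def zero_cl101_def)

lemma cl_delta_pair: "cl_delta * cl_pair a b = cl_pair b a * cl_delta"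
  by (simp add: cl_delta_def cl_pair_def times_cl101_def)

lemma of_real_cl: "of_real a = cl_pair a a"
  by (simp add: of_real_def cl_pair_def scaleR_cl101_def one_cl101_def)

lemma star_cl: "star (cl_pair a b + cl_pair a' b' * cl_delta) = cl_pair a b + cl_pair b' a' * cl_delta"
  by (simp flip: Cl_eq add: star_cl101_def)

definition is_dual_number :: "cl101 \<Rightarrow> bool" where
  "is_dual_number z \<longleftrightarrow> (\<exists>a b :: real. z = of_real a + of_real b * cl_delta)"

definition star_adjoint :: "'a :: star_algebra mat \<Rightarrow> 'a mat" where
  "star_adjoint M = mat (dim_col M) (dim_row M) (\<lambda>(i, j). star (M $$ (j, i)))"

definition star_self_adjoint :: "'a :: star_algebra mat \<Rightarrow> bool" where
  "star_self_adjoint M \<longleftrightarrow> star_adjoint M = M"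

text \<open>Over a noncommutative ring, $U^* = U^{-1}$ is read as: $U^*$ is a two-sided inverse of $U$.\<close>

definition star_unitary :: "'a :: star_algebra mat \<Rightarrow> bool" where
  "star_unitary U \<longleftrightarrow>
    square_mat U \<and> inverts_mat U (star_adjoint U) \<and> inverts_mat (star_adjoint U) U"

end

theory Submission
  imports Defs "Jordan_Normal_Form.Spectral_Radius"
begin

text \<open>A self-adjoint matrix has the form $H = (A, B) + (C, C^T)\delta$ with $A$, $B$ real symmetric
  and $C$ an arbitrary real matrix. Conjugation by the unitary $1 + (X, -X^T)\delta$ fixes $A$ and
  $B$ and adds $XB - AX$ to $C$. The map $X \mapsto XB - AX$ is self-adjoint for the Frobenius
  product, so modulo its range $C$ may be replaced by some $C_0$ in its kernel: $A C_0 = C_0 B$.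
  Then $B$ commutes with $C_0^T C_0$ and $A$ with $C_0 C_0^T$, so there is a singular value
  decomposition $C_0 = P c Q^T$ whose singular vectors are eigenvectors of $A$ and $B$. Conjugation
  by $(P, Q)$ diagonalises $H$, with eigenvalues $(a_i, b_i) + (c_i, c_i)\delta$ where
  $a_i c_i = c_i b_i$, that is, $a_i = b_i$ or $c_i = 0$.\<close>

section \<open>Real symmetric matrices\<close>

lemma scalar_prod_self_eq_0_iff:
  fixes v :: "real vec"
  shows "v \<bullet> v = 0 \<longleftrightarrow> v = 0\<^sub>v (dim_vec v)"
proof
  assume "v \<bullet> v = 0"
  then have "\<forall>i\<in>{0..<dim_vec v}. v $ i * v $ i = 0"
    unfolding scalar_prod_def by (subst (asm) sum_nonneg_eq_0_iff) auto
  then show "v = 0\<^sub>v (dim_vec v)" by (intro eq_vecI) auto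
next
  assume "v = 0\<^sub>v (dim_vec v)"
  then show "v \<bullet> v = 0" by (metis scalar_prod_left_zero zero_carrier_vec)
qed

lemma scalar_prod_self_nonneg: "v \<bullet> v \<ge> (0 :: real)"
  unfolding scalar_prod_def by (auto intro: sum_nonneg)

lemma scalar_prod_self_pos:
  assumes "v \<in> carrier_vec n" "v \<noteq> 0\<^sub>v n"
  shows "v \<bullet> v > (0 :: real)"
  using assms scalar_prod_self_nonneg[of v] scalar_prod_self_eq_0_iff[of v] by force

lemma symmetric_scalar_prod:
  fixes A :: "real mat"
  assumes "A \<in> carrier_mat n n" "A\<^sup>T = A" "x \<in> carrier_vec n" "y \<in> carrier_vec n"
  shows "(A *\<^sub>v x) \<bullet> y = x \<bullet> (A *\<^sub>v y)"
  using transpose_vec_mult_scalar[of A n n y x] assms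
  by (metis comm_scalar_prod mult_mat_vec_carrier)

lemma normalise_eigenvector:
  fixes A :: "real mat"
  assumes "A \<in> carrier_mat n n" "v \<in> carrier_vec n" "v \<noteq> 0\<^sub>v n" "A *\<^sub>v v = a \<cdot>\<^sub>v v"
  obtains r where "(r \<cdot>\<^sub>v v) \<bullet> (r \<cdot>\<^sub>v v) = 1" "A *\<^sub>v (r \<cdot>\<^sub>v v) = a \<cdot>\<^sub>v (r \<cdot>\<^sub>v v)"
proof
  let ?r = "1 / sqrt (v \<bullet> v)"
  have "v \<bullet> v > 0" using scalar_prod_self_pos assms by blast
  then show "(?r \<cdot>\<^sub>v v) \<bullet> (?r \<cdot>\<^sub>v v) = 1"
    using assms by (simp add: field_simps)
  show "A *\<^sub>v (?r \<cdot>\<^sub>v v) = a \<cdot>\<^sub>v (?r \<cdot>\<^sub>v v)"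
    using assms by (simp add: mult_mat_vec smult_smult_assoc mult.commute)
qed

text \<open>A complex eigenvector \<open>w = x + i y\<close> exists because \<open>n > 0\<close>.
  Symmetry of \<open>A\<close> forces its eigenvalue \<open>z\<close> to be real, so
  \<open>x\<close> and \<open>y\<close> satisfy the eigenvector equation separately and one of them
  is nonzero.\<close>

lemma symmetric_eigenvector:
  fixes A :: "real mat"
  assumes A: "A \<in> carrier_mat n n" "A\<^sup>T = A" and n: "n > 0"
  obtains u a where "u \<in> carrier_vec n" "u \<bullet> u = 1" "A *\<^sub>v u = a \<cdot>\<^sub>v u"
proof -
  let ?A = "map_mat complex_of_real A"
  have cA: "?A \<in> carrier_mat n n" using A by simp
  obtain z w where "eigenvector ?A w z"
    using spectrum_non_empty[OF cA n] unfolding spectrum_def eigenvalue_def by auto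
  then have w: "w \<in> carrier_vec n" "w \<noteq> 0\<^sub>v n" and Aw: "?A *\<^sub>v w = z \<cdot>\<^sub>v w"
    using cA by (auto simp: eigenvector_def)
  define x where "x = map_vec Re w"
  define y where "y = map_vec Im w"
  have xy: "x \<in> carrier_vec n" "y \<in> carrier_vec n" using w by (auto simp: x_def y_def)
  have comp: "(\<Sum>k = 0..<n. complex_of_real (A $$ (i, k)) * w $ k) = z * w $ i" if "i < n" for i
    using arg_cong[OF Aw, of "\<lambda>v. v $ i"] that w A by (simp add: scalar_prod_def)
  have Ax: "A *\<^sub>v x = Re z \<cdot>\<^sub>v x - Im z \<cdot>\<^sub>v y"
  proof (rule eq_vecI)
    fix i assume "i < dim_vec (Re z \<cdot>\<^sub>v x - Im z \<cdot>\<^sub>v y)"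
    then have i: "i < n" using xy by simp
    show "(A *\<^sub>v x) $ i = (Re z \<cdot>\<^sub>v x - Im z \<cdot>\<^sub>v y) $ i"
      using arg_cong[OF comp[OF i], of Re] i A w by (simp add: scalar_prod_def x_def y_def)
  qed (use A xy in auto)
  have Ay: "A *\<^sub>v y = Im z \<cdot>\<^sub>v x + Re z \<cdot>\<^sub>v y"
  proof (rule eq_vecI)
    fix i assume "i < dim_vec (Im z \<cdot>\<^sub>v x + Re z \<cdot>\<^sub>v y)"
    then have i: "i < n" using xy by simp
    show "(A *\<^sub>v y) $ i = (Im z \<cdot>\<^sub>v x + Re z \<cdot>\<^sub>v y) $ i"
      using arg_cong[OF comp[OF i], of Im] i A w by (simp add: scalar_prod_def x_def y_def)
  qed (use A xy in auto)
  have nz: "x \<noteq> 0\<^sub>v n \<or> y \<noteq> 0\<^sub>v n"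
  proof (rule ccontr)
    assume "\<not> ?thesis"
    then have xy0: "x = 0\<^sub>v n" "y = 0\<^sub>v n" by auto
    have "w $ i = 0" if i: "i < n" for i
      using arg_cong[OF xy0(1), of "\<lambda>v. v $ i"] arg_cong[OF xy0(2), of "\<lambda>v. v $ i"] i w
      by (simp add: x_def y_def complex_eq_iff)
    then have "w = 0\<^sub>v n" using w by (intro eq_vecI) auto
    then show False using w by simp
  qed
  have "(A *\<^sub>v x) \<bullet> y = x \<bullet> (A *\<^sub>v y)"
    using A xy by (intro symmetric_scalar_prod)
  \<comment> \<open>The left side of the symmetry relation is \<open>Re z\<close> times x.y minus
    \<open>Im z\<close> times y.y; the right side is \<open>Im z\<close> times x.x plus
    \<open>Re z\<close> times x.y. The terms in \<open>Re z\<close> cancel.\<close>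
  then have "Im z * (x \<bullet> x + y \<bullet> y) = 0"
    unfolding Ax Ay using xy
    by (simp add: minus_scalar_prod_distrib[of _ n] scalar_prod_add_distrib[of _ n] algebra_simps)
  moreover have "x \<bullet> x + y \<bullet> y > 0"
    using nz scalar_prod_self_pos[of x n] scalar_prod_self_pos[of y n] xy
      scalar_prod_self_nonneg[of x] scalar_prod_self_nonneg[of y] by fastforce
  ultimately have "Im z = 0" by auto
  then have "A *\<^sub>v x = Re z \<cdot>\<^sub>v x" "A *\<^sub>v y = Re z \<cdot>\<^sub>v y"
    unfolding Ax Ay using xy by auto
  with nz obtain v where v: "v \<in> carrier_vec n" "v \<noteq> 0\<^sub>v n" "A *\<^sub>v v = Re z \<cdot>\<^sub>v v"
    using xy by blast
  obtain r where "(r \<cdot>\<^sub>v v) \<bullet> (r \<cdot>\<^sub>v v) = 1" "A *\<^sub>v (r \<cdot>\<^sub>v v) = Re z \<cdot>\<^sub>v (r \<cdot>\<^sub>v v)"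
    using normalise_eigenvector[OF A(1) v] .
  then show thesis using that v(1) by (metis smult_carrier_vec)
qed

section \<open>Orthogonal matrices and completion of a unit vector to an orthonormal basis\<close>

definition orthogonal_matrix :: "nat \<Rightarrow> real mat \<Rightarrow> bool" where
  "orthogonal_matrix n P \<longleftrightarrow> P \<in> carrier_mat n n \<and> P\<^sup>T * P = 1\<^sub>m n \<and> P * P\<^sup>T = 1\<^sub>m n"

lemma orthogonal_matrixD:
  assumes "orthogonal_matrix n P"
  shows "P \<in> carrier_mat n n" "dim_row P = n" "dim_col P = n" "P\<^sup>T * P = 1\<^sub>m n" "P * P\<^sup>T = 1\<^sub>m n"
  using assms by (auto simp: orthogonal_matrix_def)

lemma orthogonal_matrix_cancel:
  assumes "orthogonal_matrix n P" "M \<in> carrier_mat n k"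
  shows "P\<^sup>T * (P * M) = M" "P * (P\<^sup>T * M) = M"
  using assms assoc_mult_mat[of "P\<^sup>T" n n P n M k] assoc_mult_mat[of P n n "P\<^sup>T" n M k]
  by (simp_all add: orthogonal_matrix_def del: assoc_mult_mat)

lemma orthogonal_matrix_cancel_vec:
  assumes "orthogonal_matrix n P" "v \<in> carrier_vec n"
  shows "P\<^sup>T *\<^sub>v (P *\<^sub>v v) = v" "P *\<^sub>v (P\<^sup>T *\<^sub>v v) = v"
  using assms assoc_mult_mat_vec[of "P\<^sup>T" n n P n v] assoc_mult_mat_vec[of P n n "P\<^sup>T" n v]
  by (simp_all add: orthogonal_matrix_def del: assoc_mult_mat_vec)

lemma orthogonal_matrix_mult:
  assumes "orthogonal_matrix n P" "orthogonal_matrix n Q"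
  shows "orthogonal_matrix n (P * Q)"
  using assms orthogonal_matrix_cancel[OF assms(1)] orthogonal_matrix_cancel[OF assms(2)]
  unfolding orthogonal_matrix_def
  by (auto simp: transpose_mult[of _ n n _ n] assoc_mult_mat[of _ n n _ n _ n])

lemma orthogonal_matrix_first_column:
  assumes u: "u \<in> carrier_vec n" "u \<bullet> u = 1" and n: "n > 0"
  obtains P where "orthogonal_matrix n P" "P *\<^sub>v unit_vec n 0 = u"
proof -
  \<comment> \<open>Householder reflection exchanging \<open>u\<close> and the first unit vector; if these coincide then \<open>s = 1 / 0 = 0\<close>
    and \<open>W\<close> is the identity.\<close>
  define w where "w i = u $ i - (if i = 0 then 1 else 0)" for i
  define s where "s = 1 / (1 - u $ 0)"
  define W where "W = mat n n (\<lambda>(i, j). (if i = j then 1 else 0) - s * w i * w j)"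
  have W: "W \<in> carrier_mat n n" by (simp add: W_def)
  have W_sym: "W\<^sup>T = W" by (auto simp: W_def)
  have su: "(\<Sum>i = 0..<n. u $ i * u $ i) = 1" using u by (simp add: scalar_prod_def)
  have "(\<Sum>k = 0..<n. w k * w k)
      = (\<Sum>k = 0..<n. u $ k * u $ k + (if k = 0 then 1 - 2 * u $ 0 else 0))"
    by (intro sum.cong) (auto simp: w_def algebra_simps)
  then have sw: "(\<Sum>k = 0..<n. w k * w k) = 2 * (1 - u $ 0)"
    using su n by (simp add: sum.distrib)
  \<comment> \<open>Since \<open>s\<close> is 2 divided by the squared length of \<open>w\<close>,
    the matrix \<open>W\<close> is the reflection along \<open>w\<close>; this identity is what
    makes it an involution. It also holds in the degenerate case \<open>s = 0\<close>.\<close>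
  have ssw: "s * (s * (\<Sum>k = 0..<n. w k * w k)) = 2 * s"
  proof -
    have "s * (s * (2 * (1 - u $ 0))) = 2 * s * (s * (1 - u $ 0))" by (simp only: ac_simps)
    moreover have "s * (1 - u $ 0) = 1 \<or> s = 0" by (auto simp: s_def)
    ultimately show ?thesis unfolding sw by (elim disjE) simp_all
  qed
  have "W * W = 1\<^sub>m n"
  proof (rule eq_matI)
    fix i j assume "i < dim_row (1\<^sub>m n :: real mat)" "j < dim_col (1\<^sub>m n :: real mat)"
    then have ij: "i < n" "j < n" by auto
    have "(W * W) $$ (i, j) = (\<Sum>k = 0..<n. ((if i = k then 1 else 0) - s * w i * w k)
        * ((if k = j then 1 else 0) - s * w k * w j))"
      using ij W by (simp add: scalar_prod_def W_def)
    also have "\<dots> = (\<Sum>k = 0..<n. (if k = i then (if i = j then 1 else 0) - s * w i * w j else 0)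
        - (if k = j then s * w i * w j else 0) + s * s * w i * w j * (w k * w k))"
      by (intro sum.cong) (auto simp: algebra_simps)
    also have "\<dots> = (if i = j then 1 else 0) - 2 * s * w i * w j
        + (s * (s * (\<Sum>k = 0..<n. w k * w k))) * w i * w j"
      using ij by (simp add: sum.distrib sum_subtractf sum_distrib_left algebra_simps)
    finally show "(W * W) $$ (i, j) = 1\<^sub>m n $$ (i, j)"
      unfolding ssw using ij by simp
  qed (use W in auto)
  then have orth: "orthogonal_matrix n W" using W W_sym by (simp add: orthogonal_matrix_def)
  \<comment> \<open>This gives the first column of \<open>W\<close>: subtracting
    \<open>s * w i * w 0\<close> from the first unit vector adds \<open>w\<close> to it, which
    yields \<open>u\<close>. If \<open>u $ 0 = 1\<close>, then \<open>w\<close> has length 0 and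
    both sides vanish.\<close>
  have sw0: "s * w i * w 0 = - w i" if "i < n" for i
  proof (cases "u $ 0 = 1")
    case True
    then have "(\<Sum>k = 0..<n. w k * w k) = 0" using sw by simp
    then have "\<forall>k\<in>{0..<n}. w k * w k = 0" by (subst (asm) sum_nonneg_eq_0_iff) auto
    then show ?thesis using that by auto
  next
    case False
    then have "s * w 0 = - 1" by (simp add: w_def s_def divide_eq_eq)
    then show ?thesis by (metis mult.assoc mult.commute mult_minus1)
  qed
  have "W *\<^sub>v unit_vec n 0 = u"
  proof (rule eq_vecI)
    fix i assume "i < dim_vec u"
    then have i: "i < n" using u by simp
    have "(W *\<^sub>v unit_vec n 0) $ i = (if i = 0 then 1 else 0) - s * w i * w 0"
      using i n W by (simp add: W_def)
    also have "\<dots> = u $ i" unfolding sw0[OF i] by (simp add: w_def)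
    finally show "(W *\<^sub>v unit_vec n 0) $ i = u $ i" .
  qed (use W u in auto)
  then show thesis using orth that by blast
qed

section \<open>Bordered matrices and deflation\<close>

text \<open>The shape reached once an eigenvector or a singular pair has been split off. The sizes
  of the zero blocks are read off from \<open>M\<close>.\<close>

definition bordered :: "real \<Rightarrow> real mat \<Rightarrow> real mat" where
  "bordered c M = four_block_mat (mat 1 1 (\<lambda>_. c)) (0\<^sub>m 1 (dim_col M)) (0\<^sub>m (dim_row M) 1) M"

lemma bordered_carrier [simp]: "M \<in> carrier_mat m k \<Longrightarrow> bordered c M \<in> carrier_mat (Suc m) (Suc k)"
  using four_block_carrier_mat[of "mat 1 1 (\<lambda>_. c)" 1 1 M m k] by (simp add: bordered_def)

lemma bordered_mult:
  assumes "M \<in> carrier_mat m m" "N \<in> carrier_mat m m"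
  shows "bordered a M * bordered b N = bordered (a * b) (M * N)"
proof -
  have "bordered a M * bordered b N =
    four_block_mat (mat 1 1 (\<lambda>_. a) * mat 1 1 (\<lambda>_. b) + 0\<^sub>m 1 m * 0\<^sub>m m 1)
      (mat 1 1 (\<lambda>_. a) * 0\<^sub>m 1 m + 0\<^sub>m 1 m * N)
      (0\<^sub>m m 1 * mat 1 1 (\<lambda>_. b) + M * 0\<^sub>m m 1) (0\<^sub>m m 1 * 0\<^sub>m 1 m + M * N)"
    unfolding bordered_def using assms by (simp add: mult_four_block_mat[of _ 1 1 _ m _ m _ _ 1 _ m])
  also have "\<dots> = bordered (a * b) (M * N)"
    unfolding bordered_def using assms
    by (intro cong_four_block_mat eq_matI) (auto simp: scalar_prod_def)
  finally show ?thesis .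
qed

lemma bordered_transpose: "(bordered c M)\<^sup>T = bordered c M\<^sup>T"
  by (rule eq_matI) (auto simp: bordered_def)

lemma bordered_one: "bordered 1 (1\<^sub>m m) = 1\<^sub>m (Suc m)"
  by (rule eq_matI) (auto simp: bordered_def)

text \<open>Carries symmetry and the intertwining relation from a bordered matrix down to its block,
  where they become hypotheses for the induction.\<close>

lemma bordered_inject:
  assumes "bordered a M = bordered b N"
  shows "M = N"
proof -
  have d: "dim_row M = dim_row N" "dim_col M = dim_col N"
    using arg_cong[OF assms, of dim_row] arg_cong[OF assms, of dim_col] by (auto simp: bordered_def)
  show ?thesis
  proof (rule eq_matI)
    fix i j assume "i < dim_row N" "j < dim_col N"
    then show "M $$ (i, j) = N $$ (i, j)"
      using arg_cong[OF assms, of "\<lambda>X. X $$ (Suc i, Suc j)"] d by (simp add: bordered_def)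
  qed (use d in auto)
qed

lemma bordered_mat_diag: "bordered a (mat_diag m f) = mat_diag (Suc m) (case_nat a f)"
  by (rule eq_matI) (auto simp: bordered_def mat_diag_def split: nat.splits)

lemma orthogonal_matrix_bordered:
  "orthogonal_matrix m P \<Longrightarrow> orthogonal_matrix (Suc m) (bordered 1 P)"
  by (auto simp: orthogonal_matrix_def bordered_transpose bordered_mult[of _ m] bordered_one)

text \<open>In the bases formed by the columns of \<open>P\<close> and \<open>Q\<close>, the two
  singular vector equations say that the first column and the first row of
  \<open>P\<^sup>T * C * Q\<close> are \<open>c\<close> times the first unit vector. For symmetric
  \<open>C\<close> and \<open>P = Q\<close>, an eigenvector equation serves as both, so the same
  lemma deflates symmetric matrices.\<close>

lemma singular_pair_deflation:
  assumes C: "C \<in> carrier_mat (Suc m) (Suc m)"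
    and P: "orthogonal_matrix (Suc m) P" "P *\<^sub>v unit_vec (Suc m) 0 = u"
    and Q: "orthogonal_matrix (Suc m) Q" "Q *\<^sub>v unit_vec (Suc m) 0 = v"
    and uv: "C *\<^sub>v v = c \<cdot>\<^sub>v u" "C\<^sup>T *\<^sub>v u = c \<cdot>\<^sub>v v"
  obtains C' where "C' \<in> carrier_mat m m" "C = P * bordered c C' * Q\<^sup>T"
proof -
  let ?e = "unit_vec (Suc m) 0 :: real vec"
  define M where "M = P\<^sup>T * (C * Q)"
  define C' where "C' = mat m m (\<lambda>(i, j). M $$ (Suc i, Suc j))"
  note PQ = orthogonal_matrixD(1)[OF P(1)] orthogonal_matrixD(1)[OF Q(1)]
  have M: "M \<in> carrier_mat (Suc m) (Suc m)"
    using PQ C by (auto simp: M_def)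
  have MT: "M\<^sup>T = Q\<^sup>T * (C\<^sup>T * P)"
    using PQ C unfolding M_def by (simp add: transpose_mult[of _ "Suc m" "Suc m" _ "Suc m"])
  have "M *\<^sub>v ?e = P\<^sup>T *\<^sub>v (C *\<^sub>v (Q *\<^sub>v ?e))"
    using PQ C unfolding M_def by (simp add: assoc_mult_mat_vec[of _ "Suc m" "Suc m" _ "Suc m"])
  also have "\<dots> = P\<^sup>T *\<^sub>v (P *\<^sub>v (c \<cdot>\<^sub>v ?e))"
    using PQ uv P(2) Q(2) by (simp add: mult_mat_vec[of _ "Suc m" "Suc m"])
  also have "\<dots> = c \<cdot>\<^sub>v ?e" using P by (simp add: orthogonal_matrix_cancel_vec)
  finally have Me: "M *\<^sub>v ?e = c \<cdot>\<^sub>v ?e" .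
  have "M\<^sup>T *\<^sub>v ?e = Q\<^sup>T *\<^sub>v (C\<^sup>T *\<^sub>v (P *\<^sub>v ?e))"
    using PQ C unfolding MT by (simp add: assoc_mult_mat_vec[of _ "Suc m" "Suc m" _ "Suc m"])
  also have "\<dots> = Q\<^sup>T *\<^sub>v (Q *\<^sub>v (c \<cdot>\<^sub>v ?e))"
    using PQ uv P(2) Q(2) by (simp add: mult_mat_vec[of _ "Suc m" "Suc m"])
  also have "\<dots> = c \<cdot>\<^sub>v ?e" using Q by (simp add: orthogonal_matrix_cancel_vec)
  finally have MTe: "M\<^sup>T *\<^sub>v ?e = c \<cdot>\<^sub>v ?e" .
  have col0: "M $$ (i, 0) = (if i = 0 then c else 0)" if "i < Suc m" for i
    using arg_cong[OF Me, of "\<lambda>x. x $ i"] that M by simp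
  have row0: "M $$ (0, j) = (if j = 0 then c else 0)" if "j < Suc m" for j
    using arg_cong[OF MTe, of "\<lambda>x. x $ j"] that M by simp
  have "M = bordered c C'"
  proof (rule eq_matI)
    fix i j assume "i < dim_row (bordered c C')" "j < dim_col (bordered c C')"
    then show "M $$ (i, j) = bordered c C' $$ (i, j)"
      using col0 row0 by (cases i; cases j) (auto simp: bordered_def C'_def)
  qed (use M in \<open>auto simp: bordered_def C'_def\<close>)
  moreover have "C = P * M * Q\<^sup>T"
    using PQ C P(1) Q(1) orthogonal_matrixD(5)[OF Q(1)] unfolding M_def
    by (simp add: assoc_mult_mat[of _ "Suc m" "Suc m" _ "Suc m" _ "Suc m"]
        orthogonal_matrix_cancel[of "Suc m"])
  ultimately show thesis using that[of C'] by (simp add: C'_def)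
qed

text \<open>The inductive step in reverse: bordering is multiplicative, so a factorisation of the
  block lifts to the whole matrix. The split-off value comes first on the new diagonal and
  \<open>f\<close> is shifted by one.\<close>

lemma bordered_diagonal_assembly:
  assumes "P \<in> carrier_mat (Suc m) (Suc m)" "Q \<in> carrier_mat (Suc m) (Suc m)"
    and "P' \<in> carrier_mat m m" "Q' \<in> carrier_mat m m"
  shows "P * bordered c (P' * mat_diag m f * Q'\<^sup>T) * Q\<^sup>T
    = (P * bordered 1 P') * mat_diag (Suc m) (case_nat c f) * (Q * bordered 1 Q')\<^sup>T"
proof -
  have "bordered c (P' * mat_diag m f * Q'\<^sup>T)
      = bordered 1 P' * bordered c (mat_diag m f) * bordered 1 Q'\<^sup>T"
    using assms by (simp add: bordered_mult[of _ m])
  then show ?thesis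
    using assms
    by (simp add: assoc_mult_mat[of _ "Suc m" "Suc m" _ "Suc m" _ "Suc m"]
        transpose_mult[of _ "Suc m" "Suc m" _ "Suc m"] bordered_transpose bordered_mat_diag
        mult_carrier_mat[of _ "Suc m" "Suc m" _ "Suc m"])
qed

section \<open>Spectral theorem and eigenvectors in invariant sets\<close>

lemma real_spectral_theorem:
  fixes A :: "real mat"
  assumes "A \<in> carrier_mat n n" "A\<^sup>T = A"
  shows "\<exists>P a. orthogonal_matrix n P \<and> A = P * mat_diag n a * P\<^sup>T"
  using assms
proof (induction n arbitrary: A)
  case 0
  then show ?case
    by (intro exI[of _ "1\<^sub>m 0"] exI[of _ "\<lambda>_. 0"]) (auto simp: orthogonal_matrix_def)
next
  case (Suc m)
  obtain u a where u: "u \<in> carrier_vec (Suc m)" "u \<bullet> u = 1" "A *\<^sub>v u = a \<cdot>\<^sub>v u"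
    using symmetric_eigenvector[OF Suc.prems] by blast
  obtain P where P: "orthogonal_matrix (Suc m) P" "P *\<^sub>v unit_vec (Suc m) 0 = u"
    using orthogonal_matrix_first_column[OF u(1,2)] by blast
  note PC = orthogonal_matrixD(1)[OF P(1)]
  obtain A' where A': "A' \<in> carrier_mat m m" "A = P * bordered a A' * P\<^sup>T"
    using singular_pair_deflation[OF Suc.prems(1) P P u(3)] u(3) Suc.prems(2) by auto
  \<comment> \<open>Solving for the bordered matrix exhibits it as a conjugate of \<open>A\<close>,
    so it is symmetric, and with it the block \<open>A'\<close>.\<close>
  have "bordered a A' = P\<^sup>T * (A * P)"
    using A' P(1) PC orthogonal_matrixD(4)[OF P(1)]
    by (simp add: assoc_mult_mat[of _ "Suc m" "Suc m" _ "Suc m" _ "Suc m"]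
        orthogonal_matrix_cancel[where k = "Suc m"] mult_carrier_mat[of _ "Suc m" "Suc m" _ "Suc m"]
        right_mult_one_mat[of _ "Suc m" "Suc m"])
  then have "(bordered a A')\<^sup>T = bordered a A'"
    using Suc.prems PC by (simp add: transpose_mult[of _ "Suc m" "Suc m" _ "Suc m"])
  then have "A'\<^sup>T = A'" by (metis bordered_transpose bordered_inject)
  then obtain P' f where P': "orthogonal_matrix m P'" "A' = P' * mat_diag m f * P'\<^sup>T"
    using Suc.IH A'(1) by blast
  have "A = (P * bordered 1 P') * mat_diag (Suc m) (case_nat a f) * (P * bordered 1 P')\<^sup>T"
    unfolding A'(2) P'(2) by (intro bordered_diagonal_assembly PC orthogonal_matrixD(1)[OF P'(1)])
  then show ?case
    using orthogonal_matrix_mult[OF P(1) orthogonal_matrix_bordered[OF P'(1)]] by blast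
qed

text \<open>Supplies common eigenvectors: \<open>V\<close> will be an eigenspace or a kernel that
  \<open>A\<close> preserves. Invariance is stated for the shifts of \<open>A\<close> by scalars,
  the operation that the proof applies to members of \<open>V\<close>.\<close>

lemma eigenvector_in_invariant_set:
  fixes A :: "real mat"
  assumes A: "A \<in> carrier_mat n n" "A\<^sup>T = A"
    and V: "V \<subseteq> carrier_vec n" "v0 \<in> V" "v0 \<noteq> 0\<^sub>v n"
    and inv: "\<And>v c. v \<in> V \<Longrightarrow> A *\<^sub>v v - c \<cdot>\<^sub>v v \<in> V"
  obtains v a where "v \<in> V" "v \<noteq> 0\<^sub>v n" "A *\<^sub>v v = a \<cdot>\<^sub>v v"
proof -
  obtain P d where P: "orthogonal_matrix n P" and AP: "A = P * mat_diag n d * P\<^sup>T"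
    using real_spectral_theorem[OF A] by blast
  note PC = orthogonal_matrixD(1)[OF P]
  \<comment> \<open>A nonzero vector of \<open>V\<close> with fewest coordinates in an eigenbasis of \<open>A\<close> is an eigenvector:
    otherwise subtracting an eigenvalue from \<open>A\<close> would kill one coordinate but not the vector.\<close>
  define supp where "supp v = {i. i < n \<and> (P\<^sup>T *\<^sub>v v) $ i \<noteq> 0}" for v
  obtain v where v: "v \<in> V" "v \<noteq> 0\<^sub>v n"
    and least: "\<And>w. w \<in> V \<Longrightarrow> w \<noteq> 0\<^sub>v n \<Longrightarrow> card (supp v) \<le> card (supp w)"
    using ex_has_least_nat[of "\<lambda>v. v \<in> V \<and> v \<noteq> 0\<^sub>v n" v0 "\<lambda>v. card (supp v)"] V by blast
  have vc: "v \<in> carrier_vec n" using v V by blast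
  define y where "y = P\<^sup>T *\<^sub>v v"
  have y: "y \<in> carrier_vec n" using PC vc by (simp add: y_def)
  have "P *\<^sub>v y = v" unfolding y_def using P vc by (rule orthogonal_matrix_cancel_vec)
  then have "y \<noteq> 0\<^sub>v n" using v PC by auto
  then obtain j where j: "j < n" "y $ j \<noteq> 0" using y by (metis carrier_vecD eq_vecI index_zero_vec)
  have PTA: "P\<^sup>T *\<^sub>v (A *\<^sub>v v) = mat_diag n d *\<^sub>v y"
    unfolding AP y_def using PC vc P
    by (simp add: assoc_mult_mat_vec[of _ n n _ n] mult_carrier_mat[of _ n n _ n]
        mult_mat_vec_carrier[of _ n n] orthogonal_matrix_cancel_vec)
  define w where "w = A *\<^sub>v v - d j \<cdot>\<^sub>v v"
  have PTw: "(P\<^sup>T *\<^sub>v w) $ i = (d i - d j) * y $ i" if "i < n" for i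
  proof -
    have "P\<^sup>T *\<^sub>v w = mat_diag n d *\<^sub>v y - d j \<cdot>\<^sub>v y"
      unfolding w_def using PC vc A(1) PTA
      by (simp add: mult_minus_distrib_mat_vec[of _ n n] mult_mat_vec[of _ n n] y_def
          mult_mat_vec_carrier[of _ n n])
    moreover have "(mat_diag n d *\<^sub>v y) $ i = d i * y $ i"
    proof -
      have "(mat_diag n d *\<^sub>v y) $ i = (\<Sum>k = 0..<n. (if i = k then d k else 0) * y $ k)"
        using that y by (simp add: mat_diag_def scalar_prod_def)
      also have "\<dots> = (\<Sum>k = 0..<n. if k = i then d k * y $ k else 0)"
        by (intro sum.cong) auto
      finally show ?thesis using that by simp
    qed
    ultimately show ?thesis using that y by (simp add: algebra_simps)
  qed
  have "w = 0\<^sub>v n"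
  proof (rule ccontr)
    assume "w \<noteq> 0\<^sub>v n"
    moreover have "w \<in> V" unfolding w_def using inv v by blast
    ultimately have "card (supp v) \<le> card (supp w)" using least by blast
    moreover have "supp w \<subset> supp v"
    proof -
      have "supp w = {i. i < n \<and> (d i - d j) * y $ i \<noteq> 0}"
        unfolding supp_def by (rule Collect_cong) (simp only: PTw cong: conj_cong)
      moreover have "supp v = {i. i < n \<and> y $ i \<noteq> 0}" unfolding supp_def y_def ..
      ultimately show ?thesis using j by auto
    qed
    moreover have "finite (supp v)" by (simp add: supp_def)
    ultimately show False using psubset_card_mono by (metis not_le)
  qed
  have "A *\<^sub>v v = d j \<cdot>\<^sub>v v"
  proof (rule eq_vecI)
    fix i assume "i < dim_vec (d j \<cdot>\<^sub>v v)"
    then show "(A *\<^sub>v v) $ i = (d j \<cdot>\<^sub>v v) $ i"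
      using arg_cong[OF \<open>w = 0\<^sub>v n\<close>, of "\<lambda>x. x $ i"] vc A(1) by (simp add: w_def)
  qed (use vc A in auto)
  then show thesis using that v by blast
qed

section \<open>Intertwined singular value decomposition\<close>

text \<open>The matrix \<open>B\<close> preserves the eigenspaces of \<open>C\<^sup>T * C\<close>,
  which gives a common unit eigenvector \<open>v\<close>, with eigenvalue \<mu> for
  \<open>C\<^sup>T * C\<close>. If \<mu> is nonzero, \<open>u\<close> is \<open>C v\<close>
  normalised; otherwise \<open>C v = 0\<close> and \<open>u\<close> is an eigenvector of
  \<open>A\<close> in the kernel of \<open>C\<^sup>T\<close>.\<close>

lemma intertwined_singular_pair:
  fixes A B C :: "real mat"
  assumes A: "A \<in> carrier_mat n n" "A\<^sup>T = A" and B: "B \<in> carrier_mat n n" "B\<^sup>T = B"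
    and C: "C \<in> carrier_mat n n" and AC: "A * C = C * B" and n: "n > 0"
  obtains u v a b c where "u \<in> carrier_vec n" "u \<bullet> u = 1" "v \<in> carrier_vec n" "v \<bullet> v = 1"
    "A *\<^sub>v u = a \<cdot>\<^sub>v u" "B *\<^sub>v v = b \<cdot>\<^sub>v v" "C *\<^sub>v v = c \<cdot>\<^sub>v u" "C\<^sup>T *\<^sub>v u = c \<cdot>\<^sub>v v"
proof -
  have CT: "C\<^sup>T \<in> carrier_mat n n" using C by simp
  have "C\<^sup>T * A = B * C\<^sup>T"
    using arg_cong[OF AC, of transpose_mat] A B C by (simp add: transpose_mult[of _ n n _ n])
  then have CTA: "C\<^sup>T *\<^sub>v (A *\<^sub>v x) = B *\<^sub>v (C\<^sup>T *\<^sub>v x)" if "x \<in> carrier_vec n" for x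
    using that A(1) B(1) CT by (metis assoc_mult_mat_vec)
  have CB: "C *\<^sub>v (B *\<^sub>v x) = A *\<^sub>v (C *\<^sub>v x)" if "x \<in> carrier_vec n" for x
    using that A(1) B(1) C AC by (metis assoc_mult_mat_vec)
  note cv = mult_mat_vec_carrier[of _ n n]
  have gram: "(C *\<^sub>v x) \<bullet> (C *\<^sub>v x) = x \<bullet> (C\<^sup>T *\<^sub>v (C *\<^sub>v x))" if "x \<in> carrier_vec n" for x
    using that C cv transpose_vec_mult_scalar[OF C that, of "C *\<^sub>v x"]
    by (metis comm_scalar_prod transpose_carrier_mat)
  have "(C\<^sup>T * C)\<^sup>T = C\<^sup>T * C" using C by (simp add: transpose_mult[of _ n n _ n])
  then obtain v0 \<mu> where v0: "v0 \<in> carrier_vec n" "v0 \<bullet> v0 = 1" "C\<^sup>T * C *\<^sub>v v0 = \<mu> \<cdot>\<^sub>v v0"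
    using symmetric_eigenvector[of "C\<^sup>T * C" n] C n by (metis mult_carrier_mat CT)
  define V where "V = {x \<in> carrier_vec n. C\<^sup>T *\<^sub>v (C *\<^sub>v x) = \<mu> \<cdot>\<^sub>v x}"
  have "v0 \<in> V" using v0 C by (simp add: V_def assoc_mult_mat_vec[of _ n n _ n])
  \<comment> \<open>The invariance comes from
    \<open>C\<^sup>T * C * B = C\<^sup>T * A * C = B * C\<^sup>T * C\<close>, by the intertwining
    relation and its transpose.\<close>
  have Vinv: "B *\<^sub>v x - c \<cdot>\<^sub>v x \<in> V" if "x \<in> V" for x c
  proof -
    from that have x: "x \<in> carrier_vec n" "C\<^sup>T *\<^sub>v (C *\<^sub>v x) = \<mu> \<cdot>\<^sub>v x" by (auto simp: V_def)
    have "C\<^sup>T *\<^sub>v (C *\<^sub>v (B *\<^sub>v x - c \<cdot>\<^sub>v x))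
        = C\<^sup>T *\<^sub>v (C *\<^sub>v (B *\<^sub>v x)) - c \<cdot>\<^sub>v (C\<^sup>T *\<^sub>v (C *\<^sub>v x))"
      using x(1) B C by (simp add: mult_minus_distrib_mat_vec[of _ n n] mult_mat_vec[of _ n n] cv)
    also have "C\<^sup>T *\<^sub>v (C *\<^sub>v (B *\<^sub>v x)) = \<mu> \<cdot>\<^sub>v (B *\<^sub>v x)"
      using x B C A by (simp add: CB CTA cv mult_mat_vec[of _ n n])
    also have "\<mu> \<cdot>\<^sub>v (B *\<^sub>v x) - c \<cdot>\<^sub>v (C\<^sup>T *\<^sub>v (C *\<^sub>v x)) = \<mu> \<cdot>\<^sub>v (B *\<^sub>v x - c \<cdot>\<^sub>v x)"
      unfolding x(2) using x(1) B(1) by (intro eq_vecI) (auto simp: algebra_simps)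
    finally show ?thesis using x(1) B(1) by (simp add: V_def cv)
  qed
  have "v0 \<noteq> 0\<^sub>v n" using v0 by auto
  then obtain v1 b where v1: "v1 \<in> V" "v1 \<noteq> 0\<^sub>v n" "B *\<^sub>v v1 = b \<cdot>\<^sub>v v1"
    using eigenvector_in_invariant_set[OF B _ \<open>v0 \<in> V\<close> _ Vinv] by (auto simp: V_def)
  have v1V: "v1 \<in> carrier_vec n" "C\<^sup>T *\<^sub>v (C *\<^sub>v v1) = \<mu> \<cdot>\<^sub>v v1" using v1 by (auto simp: V_def)
  obtain r where r: "(r \<cdot>\<^sub>v v1) \<bullet> (r \<cdot>\<^sub>v v1) = 1" "B *\<^sub>v (r \<cdot>\<^sub>v v1) = b \<cdot>\<^sub>v (r \<cdot>\<^sub>v v1)"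
    using normalise_eigenvector[OF B(1) v1V(1) v1(2,3)] .
  define v where "v = r \<cdot>\<^sub>v v1"
  have v: "v \<in> carrier_vec n" "v \<bullet> v = 1" "B *\<^sub>v v = b \<cdot>\<^sub>v v"
    using r v1V by (auto simp: v_def)
  have CTCv: "C\<^sup>T *\<^sub>v (C *\<^sub>v v) = \<mu> \<cdot>\<^sub>v v"
    using v1V C by (simp add: v_def mult_mat_vec[of _ n n] cv smult_smult_assoc mult.commute)
  have Cv: "C *\<^sub>v v \<in> carrier_vec n" using v C by simp
  \<comment> \<open>So \<mu> is the squared length of \<open>C v\<close>: it is nonnegative and has
    a real square root, and it vanishes only if \<open>C v = 0\<close>.\<close>
  have mu: "(C *\<^sub>v v) \<bullet> (C *\<^sub>v v) = \<mu>" using gram[OF v(1)] CTCv v by simp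
  show thesis
  proof (cases "\<mu> = 0")
    case False
    define c where "c = sqrt \<mu>"
    have c: "c \<noteq> 0" "c * c = \<mu>"
      using False mu scalar_prod_self_nonneg[of "C *\<^sub>v v"] by (auto simp: c_def)
    define u where "u = (1 / c) \<cdot>\<^sub>v (C *\<^sub>v v)"
    have "u \<in> carrier_vec n" using Cv by (simp add: u_def)
    moreover have "u \<bullet> u = 1" unfolding u_def using Cv mu c False by (simp add: field_simps)
    \<comment> \<open>Here \<open>A C v = C B v = b C v\<close>, so \<open>u\<close> inherits the
      eigenvalue \<open>b\<close> of \<open>v\<close>.\<close>
    moreover have "A *\<^sub>v (C *\<^sub>v v) = b \<cdot>\<^sub>v (C *\<^sub>v v)"
      using v C CB[OF v(1)] by (simp add: mult_mat_vec[of _ n n])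
    then have "A *\<^sub>v u = b \<cdot>\<^sub>v u"
      using A Cv by (simp add: u_def mult_mat_vec[of _ n n] smult_smult_assoc mult.commute)
    moreover have "C *\<^sub>v v = c \<cdot>\<^sub>v u" using c by (simp add: u_def smult_smult_assoc)
    moreover have "C\<^sup>T *\<^sub>v u = c \<cdot>\<^sub>v v"
    proof -
      have "\<mu> / c = c" using c by (simp add: divide_eq_eq)
      then show ?thesis
        using Cv CT CTCv by (simp add: u_def mult_mat_vec[of _ n n] smult_smult_assoc)
    qed
    ultimately show thesis using that v by blast
  next
    case True
    then have Cv0: "C *\<^sub>v v = 0\<^sub>v n"
      using mu Cv scalar_prod_self_pos by force
    moreover have "v \<noteq> 0\<^sub>v n" using v by auto
    \<comment> \<open>The square matrix \<open>C\<close> kills the nonzero vector \<open>v\<close>,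
      so it is singular and so is its transpose. The kernel \<open>K\<close> of the transpose is
      preserved by \<open>A\<close>, because \<open>C\<^sup>T * A = B * C\<^sup>T\<close>.\<close>
    ultimately have "det C = 0" using det_0_iff_vec_prod_zero_field[OF C] v by blast
    then have "det C\<^sup>T = 0" using det_transpose[OF C] by simp
    then obtain u0 where u0: "u0 \<in> carrier_vec n" "u0 \<noteq> 0\<^sub>v n" "C\<^sup>T *\<^sub>v u0 = 0\<^sub>v n"
      using det_0_iff_vec_prod_zero_field[OF CT] by blast
    define K where "K = {x \<in> carrier_vec n. C\<^sup>T *\<^sub>v x = 0\<^sub>v n}"
    have Kinv: "A *\<^sub>v x - c \<cdot>\<^sub>v x \<in> K" if "x \<in> K" for x c
      using that A(1) B(1) CT
      by (auto simp: K_def mult_minus_distrib_mat_vec[of _ n n] mult_mat_vec[of _ n n] cv CTA)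
    obtain u1 a where u1: "u1 \<in> K" "u1 \<noteq> 0\<^sub>v n" "A *\<^sub>v u1 = a \<cdot>\<^sub>v u1"
      using eigenvector_in_invariant_set[OF A, of K u0] Kinv u0 by (auto simp: K_def)
    have u1K: "u1 \<in> carrier_vec n" "C\<^sup>T *\<^sub>v u1 = 0\<^sub>v n" using u1 by (auto simp: K_def)
    obtain r where r: "(r \<cdot>\<^sub>v u1) \<bullet> (r \<cdot>\<^sub>v u1) = 1" "A *\<^sub>v (r \<cdot>\<^sub>v u1) = a \<cdot>\<^sub>v (r \<cdot>\<^sub>v u1)"
      using normalise_eigenvector[OF A(1) u1K(1) u1(2,3)] .
    have "C *\<^sub>v v = 0 \<cdot>\<^sub>v (r \<cdot>\<^sub>v u1)" using Cv0 u1K(1) by auto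
    moreover have "C\<^sup>T *\<^sub>v (r \<cdot>\<^sub>v u1) = 0 \<cdot>\<^sub>v v"
      using u1K CT v by (auto simp: mult_mat_vec[of _ n n])
    moreover have "r \<cdot>\<^sub>v u1 \<in> carrier_vec n" using u1K by simp
    ultimately show thesis using that r v by blast
  qed
qed

text \<open>One singular pair is deflated from all three matrices at once: \<open>A\<close> in the
  basis \<open>P\<close>, \<open>B\<close> in the basis \<open>Q\<close>, and \<open>C\<close>
  between them. The three blocks again satisfy the hypotheses, so induction on the size
  applies.\<close>

lemma intertwined_diagonalisation:
  fixes A B C :: "real mat"
  assumes "A \<in> carrier_mat n n" "A\<^sup>T = A" "B \<in> carrier_mat n n" "B\<^sup>T = B"
    "C \<in> carrier_mat n n" "A * C = C * B"
  shows "\<exists>P Q a b c. orthogonal_matrix n P \<and> orthogonal_matrix n Q \<and>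
    A = P * mat_diag n a * P\<^sup>T \<and> B = Q * mat_diag n b * Q\<^sup>T \<and> C = P * mat_diag n c * Q\<^sup>T"
  using assms
proof (induction n arbitrary: A B C)
  case 0
  have "orthogonal_matrix 0 (1\<^sub>m 0)" by (auto simp: orthogonal_matrix_def)
  moreover have "M = 1\<^sub>m 0 * mat_diag 0 f * (1\<^sub>m 0)\<^sup>T" if "M \<in> carrier_mat 0 0" for M f
    using that by auto
  ultimately show ?case using 0 by blast
next
  case (Suc m)
  note [simp] = mult_carrier_mat[of _ "Suc m" "Suc m" _ "Suc m"]
  note assoc = assoc_mult_mat[of _ "Suc m" "Suc m" _ "Suc m" _ "Suc m"]
  note tr = transpose_mult[of _ "Suc m" "Suc m" _ "Suc m"]
  obtain u v a b c where uv: "u \<in> carrier_vec (Suc m)" "u \<bullet> u = 1" "v \<in> carrier_vec (Suc m)" "v \<bullet> v = 1"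
    "A *\<^sub>v u = a \<cdot>\<^sub>v u" "B *\<^sub>v v = b \<cdot>\<^sub>v v" "C *\<^sub>v v = c \<cdot>\<^sub>v u" "C\<^sup>T *\<^sub>v u = c \<cdot>\<^sub>v v"
    using intertwined_singular_pair[OF Suc.prems] by blast
  obtain P where P: "orthogonal_matrix (Suc m) P" "P *\<^sub>v unit_vec (Suc m) 0 = u"
    using orthogonal_matrix_first_column[OF uv(1,2)] by blast
  obtain Q where Q: "orthogonal_matrix (Suc m) Q" "Q *\<^sub>v unit_vec (Suc m) 0 = v"
    using orthogonal_matrix_first_column[OF uv(3,4)] by blast
  note PC = orthogonal_matrixD(1)[OF P(1)] and QC = orthogonal_matrixD(1)[OF Q(1)]
  note PP = orthogonal_matrixD(4)[OF P(1)] and QQ = orthogonal_matrixD(4)[OF Q(1)]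
  note can = orthogonal_matrix_cancel[OF P(1), where k = "Suc m"]
    orthogonal_matrix_cancel[OF Q(1), where k = "Suc m"] right_mult_one_mat[of _ "Suc m" "Suc m"]
  obtain A' where A': "A' \<in> carrier_mat m m" "A = P * bordered a A' * P\<^sup>T"
    using singular_pair_deflation[OF Suc.prems(1) P P uv(5)] uv(5) Suc.prems(2) by auto
  obtain B' where B': "B' \<in> carrier_mat m m" "B = Q * bordered b B' * Q\<^sup>T"
    using singular_pair_deflation[OF Suc.prems(3) Q Q uv(6)] uv(6) Suc.prems(4) by auto
  obtain C' where C': "C' \<in> carrier_mat m m" "C = P * bordered c C' * Q\<^sup>T"
    using singular_pair_deflation[OF Suc.prems(5) P Q uv(7,8)] by auto
  have bA: "bordered a A' = P\<^sup>T * (A * P)" using A' PC PP by (simp add: assoc can)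
  have "(bordered a A')\<^sup>T = bordered a A'"
    unfolding bA using Suc.prems PC by (simp add: tr)
  then have A'T: "A'\<^sup>T = A'" by (metis bordered_transpose bordered_inject)
  have bB: "bordered b B' = Q\<^sup>T * (B * Q)" using B' QC QQ by (simp add: assoc can)
  have "(bordered b B')\<^sup>T = bordered b B'"
    unfolding bB using Suc.prems QC by (simp add: tr)
  then have B'T: "B'\<^sup>T = B'" by (metis bordered_transpose bordered_inject)
  have bC: "bordered c C' = P\<^sup>T * (C * Q)" using C' PC QC QQ by (simp add: assoc can)
  \<comment> \<open>Multiplying the intertwining relation by \<open>P\<^sup>T\<close> on the left
    and \<open>Q\<close> on the right turns it into an equality of bordered products, whose blocks
    give the relation for \<open>A'\<close>, \<open>B'\<close>, \<open>C'\<close>.\<close>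
  have "bordered (a * c) (A' * C') = P\<^sup>T * ((A * C) * Q)"
    using A'(1) C'(1) bA bC PC QC Suc.prems(1,5)
    by (simp add: bordered_mult[of _ m, symmetric] assoc can)
  also have "\<dots> = bordered (c * b) (C' * B')"
    unfolding Suc.prems(6) using B'(1) C'(1) bB bC PC QC Suc.prems(3,5)
    by (simp add: bordered_mult[of _ m, symmetric] assoc can)
  finally have "A' * C' = C' * B'" by (rule bordered_inject)
  then obtain P' Q' f g h where P': "orthogonal_matrix m P'" and Q': "orthogonal_matrix m Q'"
    and eqs: "A' = P' * mat_diag m f * P'\<^sup>T" "B' = Q' * mat_diag m g * Q'\<^sup>T"
      "C' = P' * mat_diag m h * Q'\<^sup>T"
    using Suc.IH[OF A'(1) A'T B'(1) B'T C'(1)] by blast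
  note P'C = orthogonal_matrixD(1)[OF P'] and Q'C = orthogonal_matrixD(1)[OF Q']
  note bda = bordered_diagonal_assembly
  have "A = (P * bordered 1 P') * mat_diag (Suc m) (case_nat a f) * (P * bordered 1 P')\<^sup>T"
    unfolding A'(2) eqs by (rule bda[OF PC PC P'C P'C])
  moreover have "B = (Q * bordered 1 Q') * mat_diag (Suc m) (case_nat b g) * (Q * bordered 1 Q')\<^sup>T"
    unfolding B'(2) eqs by (rule bda[OF QC QC Q'C Q'C])
  moreover have "C = (P * bordered 1 P') * mat_diag (Suc m) (case_nat c h) * (Q * bordered 1 Q')\<^sup>T"
    unfolding C'(2) eqs by (rule bda[OF PC QC P'C Q'C])
  ultimately show ?case
    using orthogonal_matrix_mult[OF P(1) orthogonal_matrix_bordered[OF P']]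
      orthogonal_matrix_mult[OF Q(1) orthogonal_matrix_bordered[OF Q']] by blast
qed

section \<open>Kernel and range of the Sylvester operator\<close>

text \<open>In eigenbases of \<open>A\<close> and \<open>B\<close>, passing from \<open>X\<close> to
  \<open>X * B - A * X\<close> multiplies entry (i, j) by \<open>b j - a i\<close>. Entries with
  \<open>a i = b j\<close> go into \<open>C0\<close>; all others can be divided by this factor and
  go into \<open>X\<close>.\<close>

lemma sylvester_splitting:
  fixes A B C :: "real mat"
  assumes A: "A \<in> carrier_mat n n" "A\<^sup>T = A" and B: "B \<in> carrier_mat n n" "B\<^sup>T = B"
    and C: "C \<in> carrier_mat n n"
  obtains C0 X where "C0 \<in> carrier_mat n n" "X \<in> carrier_mat n n" "A * C0 = C0 * B"
    "C = C0 + (X * B - A * X)"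
proof -
  note [simp] = mult_carrier_mat[of _ n n _ n] minus_carrier_mat
  note assoc = assoc_mult_mat[of _ n n _ n _ n]
  obtain P a where P: "orthogonal_matrix n P" and AP: "A = P * mat_diag n a * P\<^sup>T"
    using real_spectral_theorem[OF A] by blast
  obtain Q b where Q: "orthogonal_matrix n Q" and BQ: "B = Q * mat_diag n b * Q\<^sup>T"
    using real_spectral_theorem[OF B] by blast
  note PC = orthogonal_matrixD(1)[OF P] and QC = orthogonal_matrixD(1)[OF Q]
  note can = orthogonal_matrix_cancel[OF P, where k = n] orthogonal_matrix_cancel[OF Q, where k = n]
  define M where "M = P\<^sup>T * (C * Q)"
  define M0 where "M0 = mat n n (\<lambda>(i, j). if a i = b j then M $$ (i, j) else 0)"
  \<comment> \<open>Where \<open>a i = b j\<close> the quotient is \<open>0\<close> by convention.\<close>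
  define Y where "Y = mat n n (\<lambda>(i, j). M $$ (i, j) / (b j - a i))"
  have car: "M \<in> carrier_mat n n" "M0 \<in> carrier_mat n n" "Y \<in> carrier_mat n n"
    using PC QC C by (auto simp: M_def M0_def Y_def)
  have M: "M = M0 + (Y * mat_diag n b - mat_diag n a * Y)"
  proof (rule eq_matI)
    fix i j assume "i < dim_row (M0 + (Y * mat_diag n b - mat_diag n a * Y))"
      "j < dim_col (M0 + (Y * mat_diag n b - mat_diag n a * Y))"
    then have ij: "i < n" "j < n" using car by (auto simp: mat_diag_def)
    then have "(M0 + (Y * mat_diag n b - mat_diag n a * Y)) $$ (i, j)
        = M0 $$ (i, j) + (Y $$ (i, j) * b j - a i * Y $$ (i, j))"
      using car by (simp add: mat_diag_mult_left[of _ n n] mat_diag_mult_right[of _ n n])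
    also have "\<dots> = M0 $$ (i, j) + Y $$ (i, j) * (b j - a i)" by (simp add: algebra_simps)
    also have "\<dots> = M $$ (i, j)" using ij by (simp add: M0_def Y_def)
    finally show "M $$ (i, j) = (M0 + (Y * mat_diag n b - mat_diag n a * Y)) $$ (i, j)" by simp
  qed (use car in \<open>auto simp: mat_diag_def\<close>)
  \<comment> \<open>The nonzero entries of \<open>M0\<close> lie where \<open>a i = b j\<close>, so
    scaling rows by \<open>a\<close> and columns by \<open>b\<close> has the same effect.\<close>
  have M0: "mat_diag n a * M0 = M0 * mat_diag n b"
    using car(2) unfolding mat_diag_mult_left[OF car(2)] mat_diag_mult_right[OF car(2)]
    by (intro eq_matI) (auto simp: M0_def)
  define C0 where "C0 = P * M0 * Q\<^sup>T"
  define X where "X = P * Y * Q\<^sup>T"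
  show thesis
  proof
    show "C0 \<in> carrier_mat n n" "X \<in> carrier_mat n n"
      using PC QC car by (auto simp: C0_def X_def)
    have "A * C0 = P * ((mat_diag n a * M0) * Q\<^sup>T)"
      using PC QC car unfolding AP C0_def by (simp add: assoc can)
    also have "\<dots> = C0 * B"
      using PC QC car unfolding M0 BQ C0_def by (simp add: assoc can)
    finally show "A * C0 = C0 * B" .
    have AX: "A * X = P * ((mat_diag n a * Y) * Q\<^sup>T)"
      using PC QC car unfolding AP X_def by (simp add: assoc can)
    have XB: "X * B = P * ((Y * mat_diag n b) * Q\<^sup>T)"
      using PC QC car unfolding BQ X_def by (simp add: assoc can)
    have "C = P * (M * Q\<^sup>T)"
      using PC QC C orthogonal_matrixD(5)[OF Q] unfolding M_def
      by (simp add: assoc can right_mult_one_mat[of _ n n])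
    also have "\<dots> = C0 + (X * B - A * X)"
      unfolding AX XB C0_def using PC QC car
      by (subst M) (simp add: add_mult_distrib_mat[of _ n n _ _ n] mult_add_distrib_mat[of _ n n _ n]
          minus_mult_distrib_mat[of _ n n _ _ n] mult_minus_distrib_mat[of _ n n _ n] assoc)
    finally show "C = C0 + (X * B - A * X)" .
  qed
qed

section \<open>Matrices over the Clifford algebra\<close>

text \<open>\<open>cl_mat n A B C E\<close> is $(A, B) + (C, E)\delta$.\<close>

definition cl_mat :: "nat \<Rightarrow> real mat \<Rightarrow> real mat \<Rightarrow> real mat \<Rightarrow> real mat \<Rightarrow> cl101 mat" where
  "cl_mat n A B C E = mat n n (\<lambda>ij. Cl (A $$ ij) (B $$ ij) (C $$ ij) (E $$ ij))"

lemma cl_mat_carrier [simp]: "cl_mat n A B C E \<in> carrier_mat n n"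
  by (simp add: cl_mat_def)

lemma sum_Cl:
  "(\<Sum>k\<in>S. Cl (f k) (g k) (h k) (l k)) = Cl (sum f S) (sum g S) (sum h S) (sum l S)"
  by (induction S rule: infinite_finite_induct) (auto simp: zero_cl101_def plus_cl101_def)

text \<open>Moving \<delta> to the right past \<open>(A', B')\<close> swaps the pair, which is why
  \<open>C\<close> meets \<open>B'\<close> and \<open>E\<close> meets \<open>A'\<close>; the product
  of the two \<delta> parts vanishes.\<close>

lemma cl_mat_mult:
  assumes "A \<in> carrier_mat n n" "B \<in> carrier_mat n n" "C \<in> carrier_mat n n" "E \<in> carrier_mat n n"
    and "A' \<in> carrier_mat n n" "B' \<in> carrier_mat n n" "C' \<in> carrier_mat n n" "E' \<in> carrier_mat n n"
  shows "cl_mat n A B C E * cl_mat n A' B' C' E'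
    = cl_mat n (A * A') (B * B') (A * C' + C * B') (B * E' + E * A')"
proof (rule eq_matI)
  fix i j assume "i < dim_row (cl_mat n (A * A') (B * B') (A * C' + C * B') (B * E' + E * A'))"
    "j < dim_col (cl_mat n (A * A') (B * B') (A * C' + C * B') (B * E' + E * A'))"
  then have ij: "i < n" "j < n" by (auto simp: cl_mat_def)
  then have "(cl_mat n A B C E * cl_mat n A' B' C' E') $$ (i, j)
      = (\<Sum>k = 0..<n. Cl (A $$ (i, k) * A' $$ (k, j)) (B $$ (i, k) * B' $$ (k, j))
          (A $$ (i, k) * C' $$ (k, j) + C $$ (i, k) * B' $$ (k, j))
          (B $$ (i, k) * E' $$ (k, j) + E $$ (i, k) * A' $$ (k, j)))"
    by (simp add: cl_mat_def scalar_prod_def times_cl101_def)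
  then show "(cl_mat n A B C E * cl_mat n A' B' C' E') $$ (i, j)
      = cl_mat n (A * A') (B * B') (A * C' + C * B') (B * E' + E * A') $$ (i, j)"
    using assms ij by (simp add: sum_Cl cl_mat_def scalar_prod_def sum.distrib)
qed (auto simp: cl_mat_def)

lemma star_adjoint_cl_mat:
  assumes "A \<in> carrier_mat n n" "B \<in> carrier_mat n n" "C \<in> carrier_mat n n" "E \<in> carrier_mat n n"
  shows "star_adjoint (cl_mat n A B C E) = cl_mat n A\<^sup>T B\<^sup>T E\<^sup>T C\<^sup>T"
  using assms by (intro eq_matI) (auto simp: cl_mat_def star_adjoint_def star_cl101_def)

lemma cl_mat_one: "cl_mat n (1\<^sub>m n) (1\<^sub>m n) (0\<^sub>m n n) (0\<^sub>m n n) = 1\<^sub>m n"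
  by (intro eq_matI) (auto simp: cl_mat_def one_cl101_def zero_cl101_def)

text \<open>The involution fixes the first two components, so these form symmetric matrices; it
  swaps the two \<delta> components, so these are transposes of each other.\<close>

lemma star_self_adjoint_cl_mat:
  assumes H: "H \<in> carrier_mat n n" "star_self_adjoint H"
  obtains A B C where "A \<in> carrier_mat n n" "A\<^sup>T = A" "B \<in> carrier_mat n n" "B\<^sup>T = B"
    "C \<in> carrier_mat n n" "H = cl_mat n A B C C\<^sup>T"
proof
  have "star (H $$ (j, i)) = H $$ (i, j)" if "i < n" "j < n" for i j
    using arg_cong[OF H(2)[unfolded star_self_adjoint_def], of "\<lambda>M. M $$ (i, j)"] that H(1)
    by (simp add: star_adjoint_def)
  then have sym: "cl1 (H $$ (j, i)) = cl1 (H $$ (i, j))" "cl2 (H $$ (j, i)) = cl2 (H $$ (i, j))"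
    "cl4 (H $$ (i, j)) = cl3 (H $$ (j, i))" if "i < n" "j < n" for i j
    using that by (metis star_cl101_def cl101.sel)+
  show "map_mat cl1 H \<in> carrier_mat n n" "map_mat cl2 H \<in> carrier_mat n n"
    "map_mat cl3 H \<in> carrier_mat n n" using H by auto
  show "(map_mat cl1 H)\<^sup>T = map_mat cl1 H" "(map_mat cl2 H)\<^sup>T = map_mat cl2 H"
    using H sym by (auto intro!: eq_matI)
  show "H = cl_mat n (map_mat cl1 H) (map_mat cl2 H) (map_mat cl3 H) (map_mat cl3 H)\<^sup>T"
    using H(1) sym by (intro eq_matI) (auto simp: cl_mat_def intro!: cl101.expand)
qed

section \<open>Unitary diagonalisation over the Clifford algebra\<close>

theorem theorem7p1:
  fixes H :: "cl101 mat" and n :: nat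
  assumes "H \<in> carrier_mat n n"
    and "star_self_adjoint H"
  shows "\<exists>U D :: cl101 mat.
    U \<in> carrier_mat n n \<and> D \<in> carrier_mat n n \<and>
    star_unitary U \<and> diagonal_mat D \<and> H = U * D * star_adjoint U \<and>
    (\<forall>i < n. is_dual_number (D $$ (i, i)) \<or> (\<exists>x y :: real. D $$ (i, i) = cl_pair x y))"
proof -
  note [simp] = mult_carrier_mat[of _ n n _ n] carrier_matD[OF mat_diag_dim]
  note assoc = assoc_mult_mat[of _ n n _ n _ n]
  note tr = transpose_mult[of _ n n _ n]
  obtain A B C where A: "A \<in> carrier_mat n n" "A\<^sup>T = A" and B: "B \<in> carrier_mat n n" "B\<^sup>T = B"
    and C: "C \<in> carrier_mat n n" and H: "H = cl_mat n A B C C\<^sup>T"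
    using star_self_adjoint_cl_mat[OF assms] .
  obtain C0 X where C0: "C0 \<in> carrier_mat n n" "A * C0 = C0 * B" and X: "X \<in> carrier_mat n n"
    and CX: "C = C0 + (X * B - A * X)"
    using sylvester_splitting[OF A B C] by blast
  obtain P Q a b c where P: "orthogonal_matrix n P" and Q: "orthogonal_matrix n Q"
    and AP: "A = P * mat_diag n a * P\<^sup>T" and BQ: "B = Q * mat_diag n b * Q\<^sup>T"
    and CPQ: "C0 = P * mat_diag n c * Q\<^sup>T"
    using intertwined_diagonalisation[OF A B C0] by blast
  note PC = orthogonal_matrixD[OF P] and QC = orthogonal_matrixD[OF Q]
  note can = orthogonal_matrix_cancel[OF P, where k = n] orthogonal_matrix_cancel[OF Q, where k = n]
    right_mult_one_mat[of _ n n] left_mult_one_mat[of _ n n]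
  \<comment> \<open>\<open>U\<close> is the product of $1 + (X, -X^T)\delta$ and $(P, Q)$.\<close>
  define U where "U = cl_mat n P Q (X * Q) (- (X\<^sup>T * P))"
  \<comment> \<open>Both \<delta> components carry the same \<open>c\<close>, because
    \<open>C0\<close> and its transpose have the same diagonal in the bases \<open>P\<close> and
    \<open>Q\<close>.\<close>
  define D where "D = cl_mat n (mat_diag n a) (mat_diag n b) (mat_diag n c) (mat_diag n c)"
  have U': "star_adjoint U = cl_mat n P\<^sup>T Q\<^sup>T (- (P\<^sup>T * X)) (Q\<^sup>T * X\<^sup>T)"
    unfolding U_def using PC(1) QC(1) X
    by (simp add: star_adjoint_cl_mat tr transpose_uminus)
  \<comment> \<open>The adjoint of \<open>1 + (X, -X\<^sup>T)\<close> \<delta> is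
    \<open>1 - (X, -X\<^sup>T)\<close> \<delta>, which is its inverse since \<delta> squares to 0.
    Hence the \<delta> components cancel in both products.\<close>
  have UU': "U * star_adjoint U = 1\<^sub>m n"
  proof -
    have "P * (- (P\<^sup>T * X)) + X * Q * Q\<^sup>T = 0\<^sub>m n n"
      using PC(1,5) QC(1,5) X P Q by (simp add: assoc can)
    moreover have "Q * (Q\<^sup>T * X\<^sup>T) + - (X\<^sup>T * P) * P\<^sup>T = 0\<^sub>m n n"
      using PC(1,5) QC(1,5) X P Q by (simp add: assoc can add_uminus_minus_mat[of _ n n])
    ultimately show ?thesis
      unfolding U' unfolding U_def using PC QC X
      by (simp add: cl_mat_mult cl_mat_one del: assoc_mult_mat uminus_mult_left_mat uminus_mult_right_mat)
  qed
  have U'U: "star_adjoint U * U = 1\<^sub>m n"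
  proof -
    have "P\<^sup>T * (X * Q) + - (P\<^sup>T * X) * Q = 0\<^sub>m n n"
      using PC(1) QC(1) X by (simp add: assoc add_uminus_minus_mat[of _ n n])
    moreover have "Q\<^sup>T * (- (X\<^sup>T * P)) + Q\<^sup>T * X\<^sup>T * P = 0\<^sub>m n n"
      using PC(1) QC(1) X by (simp add: assoc)
    ultimately show ?thesis
      unfolding U' unfolding U_def using PC QC X
      by (simp add: cl_mat_mult cl_mat_one del: assoc_mult_mat uminus_mult_left_mat uminus_mult_right_mat)
  qed
  have UDU: "H = U * D * star_adjoint U"
  proof -
    let ?a = "mat_diag n a" and ?b = "mat_diag n b" and ?c = "mat_diag n c"
    have AX: "A * X = P * (?a * (P\<^sup>T * X))" and XB: "X * B = X * (Q * (?b * Q\<^sup>T))"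
      using PC(1) QC(1) X unfolding AP BQ by (simp_all add: assoc)
    have cT: "?c\<^sup>T = ?c" "?a\<^sup>T = ?a" "?b\<^sup>T = ?b"
      by (auto simp: mat_diag_def intro!: eq_matI)
    \<comment> \<open>The first \<delta> component of \<open>U * D * star_adjoint U\<close> is
      \<open>C0 + (X * B - A * X)\<close>, which is \<open>C\<close> by the Sylvester
      splitting.\<close>
    have c3: "P * ?a * (- (P\<^sup>T * X)) + (P * ?c + X * Q * ?b) * Q\<^sup>T = C"
    proof -
      have "P * ?a * (- (P\<^sup>T * X)) + (P * ?c + X * Q * ?b) * Q\<^sup>T = - (A * X) + (C0 + X * B)"
        unfolding AX XB CPQ using PC(1) QC(1) X
        by (simp add: assoc add_mult_distrib_mat[of _ n n _ _ n])
      also have "\<dots> = C"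
        unfolding CX using A(1) B(1) C0(1) X by (intro eq_matI) auto
      finally show ?thesis .
    qed
    \<comment> \<open>The second \<delta> component is the transpose of the first, as it must be for
      a self-adjoint product.\<close>
    have "Q * ?b * (Q\<^sup>T * X\<^sup>T) + (Q * ?c + - (X\<^sup>T * P) * ?a) * P\<^sup>T
        = (P * ?a * (- (P\<^sup>T * X)) + (P * ?c + X * Q * ?b) * Q\<^sup>T)\<^sup>T"
    proof -
      have "(P * ?a * (- (P\<^sup>T * X)) + (P * ?c + X * Q * ?b) * Q\<^sup>T)\<^sup>T
          = - (X\<^sup>T * P) * (?a * P\<^sup>T) + (Q * (?c * P\<^sup>T) + Q * (?b * (Q\<^sup>T * X\<^sup>T)))"
        using PC(1) QC(1) X
        by (simp add: assoc tr cT transpose_uminus transpose_add[of _ n n]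
            mult_add_distrib_mat[of _ n n _ n] add_mult_distrib_mat[of _ n n _ _ n])
      also have "\<dots> = Q * ?b * (Q\<^sup>T * X\<^sup>T) + (Q * ?c + - (X\<^sup>T * P) * ?a) * P\<^sup>T"
        using PC(1) QC(1) X
        by (intro eq_matI) (auto simp: assoc add_mult_distrib_mat[of _ n n _ _ n] mat_diag_def)
      finally show ?thesis by simp
    qed
    then have c4: "Q * ?b * (Q\<^sup>T * X\<^sup>T) + (Q * ?c + - (X\<^sup>T * P) * ?a) * P\<^sup>T = C\<^sup>T"
      unfolding c3 .
    show ?thesis
      unfolding H U' unfolding U_def D_def using PC(1) QC(1) X c3 c4 AP BQ
      by (simp add: cl_mat_mult del: assoc_mult_mat uminus_mult_left_mat uminus_mult_right_mat)
  qed
  \<comment> \<open>In the bases \<open>P\<close> and \<open>Q\<close>, the relation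
    \<open>A * C0 = C0 * B\<close> is an equality of diagonal matrices. It leaves the alternative
    \<open>c i = 0\<close>, giving a pair, or \<open>a i = b i\<close>, giving a dual
    number.\<close>
  have ac: "a i * c i = c i * b i" if "i < n" for i
  proof -
    have "mat_diag n a * mat_diag n c = P\<^sup>T * ((A * C0) * Q)"
      unfolding AP CPQ using PC(1) QC(1,4) P Q by (simp add: assoc can del: mat_diag_diag)
    also have "\<dots> = mat_diag n c * mat_diag n b"
      unfolding C0(2) unfolding BQ CPQ using PC(1) QC(1,4) P Q
      by (simp add: assoc can del: mat_diag_diag)
    finally have "mat_diag n (\<lambda>i. a i * c i) $$ (i, i) = mat_diag n (\<lambda>i. c i * b i) $$ (i, i)"
      by simp
    then show ?thesis using that by (simp add: mat_diag_def)
  qed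
  have "is_dual_number (D $$ (i, i)) \<or> (\<exists>x y. D $$ (i, i) = cl_pair x y)" if "i < n" for i
  proof (cases "c i = 0")
    case True
    then show ?thesis using that by (auto simp: D_def cl_mat_def mat_diag_def cl_pair_def)
  next
    case False
    with ac[OF that] have "a i = b i" by simp
    then have "D $$ (i, i) = of_real (a i) + of_real (c i) * cl_delta"
      using that by (simp add: D_def cl_mat_def mat_diag_def of_real_cl flip: Cl_eq)
    then show ?thesis unfolding is_dual_number_def by blast
  qed
  moreover have "diagonal_mat D"
    by (auto simp: diagonal_mat_def D_def cl_mat_def mat_diag_def zero_cl101_def)
  moreover have car: "U \<in> carrier_mat n n" "D \<in> carrier_mat n n" by (simp_all add: U_def D_def)
  moreover have "star_unitary U"
    using UU' U'U carrier_matD[OF car(1)]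
    by (simp add: star_unitary_def inverts_mat_def star_adjoint_def)
  ultimately show ?thesis using UDU by blast
qed

end
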